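(* Let $\alpha\in[0,1)\cup[5,\infty)$. Then for every $u\in C_c(\mathbb{N}_0)$ with $u(0)=0$, $$\sum_{n=1}^\infty |u(n)-u(n-1)|^2 n^\alpha\ \ge\ \frac{(\alpha-1)^2}{4}\sum_{n=1}^\infty \frac{|u(n)|^2}{n^2}\,n^\alpha .$$ Moreover, the constant $\frac{(\alpha-1)^2}{4}$ is sharp: for every $C>\frac{(\alpha-1)^2}{4}$, the inequality obtained by replacing $\frac{(\alpha-1)^2}{4}$ with $C$ fails for some $u\in C_c(\mathbb{N}_0)$ with $u(0)=0$.
   Context: $\mathbb{N}_0=\{0,1,2,\dots\}$. $C_c(\mathbb{N}_0)$ is the space of finitely supported real-valued functions on $\mathbb{N}_0$. *)

theory Defs
  imports "HOL-Analysis.Analysis"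
begin

definition Cc_N0 :: "(nat \<Rightarrow> real) set" where
  "Cc_N0 = {u. finite {n. u n \<noteq> 0}}"

(* For u in Cc_N0 only finitely many terms are nonzero, so the unordered sum infsum
   is the paper's series and never takes its default value for non-summable families.
   The index starts at 1, so neither the truncated subtraction n - 1, nor the value
   0 powr alpha, nor the division by n^2 is used at a degenerate argument. *)
definition hardy_ineq :: "real \<Rightarrow> real \<Rightarrow> (nat \<Rightarrow> real) \<Rightarrow> bool" where
  "hardy_ineq \<alpha> C u \<longleftrightarrow>
     (\<Sum>\<^sub>\<infinity>n\<in>{1..}. \<bar>u n - u (n - 1)\<bar>\<^sup>2 * real n powr \<alpha>)
       \<ge> C * (\<Sum>\<^sub>\<infinity>n\<in>{1..}. \<bar>u n\<bar>\<^sup>2 / (real n)\<^sup>2 * real n powr \<alpha>)"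

end

theory Submission
  imports Defs "HOL-Real_Asymp.Real_Asymp"
begin

text \<open>
  Put \<open>\<beta> = (1 - \<alpha>) / 2\<close>, so that \<open>\<alpha> = 1 - 2\<beta>\<close> and the constant is \<open>\<beta>\<^sup>2\<close>. In the
  continuous problem, \<open>t powr \<beta>\<close> solves the Euler--Lagrange equation of the weighted
  Hardy inequality. In the discrete problem its restriction to the integers is still a
  supersolution, and a positive supersolution yields the inequality by completing squares
  edge by edge and summing (\<open>hardy_of_supersolution\<close>).

  After division by \<open>n powr \<alpha>\<close>, the supersolution property at the site \<open>n\<close> is, with
  \<open>x = 1/n\<close>, the one-variable inequality
  \<open>1 - (1-x) powr \<beta> + (1+x) powr \<alpha> * (1 - (1+x) powr \<beta>) \<ge> \<beta>\<^sup>2 x\<^sup>2\<close>.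
  Both sides agree to second order at \<open>x = 0\<close>, and the coefficient of \<open>x\<^sup>3\<close> on the left is
  \<open>\<beta> (1 - 2\<beta>) (1 + \<beta>) / 2\<close>, which is nonnegative exactly for \<open>\<beta> \<le> -1\<close> and for
  \<open>0 \<le> \<beta> \<le> 1/2\<close>. The two parts of the range of \<open>\<alpha>\<close> therefore need different arguments.
  For \<open>0 < \<beta> \<le> 1/2\<close> the difference of the two sides is convex in \<open>x\<close>
  (\<open>weight_bound_pos_exponent\<close>). For \<open>\<beta> \<le> -2\<close> convexity breaks down, because
  \<open>(1-x) powr \<beta>\<close> blows up at \<open>x = 1\<close>; instead tangent-line bounds in the exponent reduce the
  claim to polynomial inequalities on \<open>0 < x \<le> 1/2\<close> (\<open>weight_bound_neg_exponent\<close>), that is, for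
  \<open>n \<ge> 2\<close>. The boundary site \<open>n = 1\<close> sees the value \<open>0\<close> at the origin and is
  treated separately (\<open>weight_bound_at_one\<close>).

  For sharpness, follow \<open>n powr \<beta>\<close> up to \<open>N\<close> and then descend linearly to \<open>0\<close> at \<open>2N\<close>.
  The right-hand sum is then at least the harmonic number \<open>H\<^sub>N\<close>, the rising part of the
  left-hand sum is \<open>\<beta>\<^sup>2 H\<^sub>N\<close> up to a factor \<open>1 + o(1)\<close>, and the cost of the descent stays bounded
  because \<open>\<alpha> + 2\<beta> = 1\<close>. Divergence of \<open>H\<^sub>N\<close> excludes every constant above \<open>\<beta>\<^sup>2\<close>.
\<close>

section \<open>Tangent-line bounds for powers\<close>

lemma powr_ge_tangent:
  fixes y r :: real
  assumes "y > 0" "r \<le> 0"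
  shows "y powr r \<ge> 1 + r * (y - 1)"
proof -
  have "r * (y - 1) \<le> r * ln y"
    using ln_le_minus_one[OF assms(1)] assms(2) by (intro mult_left_mono_neg) auto
  also have "1 + r * ln y \<le> y powr r"
    using assms(1) exp_ge_add_one_self[of "r * ln y"] by (simp add: powr_def)
  finally show ?thesis by simp
qed

lemma powr_le_tangent:
  fixes y r :: real
  assumes "y > 0" "0 \<le> r" "r \<le> 1"
  shows "y powr r \<le> 1 + r * (y - 1)"
  using Youngs_inequality_0[of r "1 - r" y 1] assms by (simp add: algebra_simps)

section \<open>Hardy inequalities from supersolutions\<close>

text \<open>
  For positive \<open>A, B\<close> the identity
  \<open>(y - x)\<^sup>2 = (1 - B/A) x\<^sup>2 + (1 - A/B) y\<^sup>2 + (B x - A y)\<^sup>2 / (A B)\<close> bounds the energy of each edge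
  from below by a diagonal form. With \<open>A\<close> and \<open>B\<close> the values of \<open>g\<close> at the two ends of the
  edge, the two edges meeting at a site \<open>n\<close> contribute exactly the left-hand side of the
  supersolution condition.
\<close>

lemma hardy_of_supersolution:
  fixes a g w u :: "nat \<Rightarrow> real"
  assumes a: "\<And>n. n \<ge> 1 \<Longrightarrow> a n \<ge> 0"
    and g: "\<And>n. n \<ge> 1 \<Longrightarrow> g n > 0" "g 0 = 0"
    and super: "\<And>n. n \<ge> 1 \<Longrightarrow>
      a n * (1 - g (n - 1) / g n) + a (Suc n) * (1 - g (Suc n) / g n) \<ge> w n"
    and u: "u 0 = 0" "u (Suc M) = 0"
  shows "(\<Sum>n=1..M. w n * (u n)\<^sup>2) \<le> (\<Sum>n=1..Suc M. a n * (u n - u (n - 1))\<^sup>2)"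
proof -
  \<comment> \<open>The extra term is the share of the last edge that its right end has received and
    that its site \<open>Suc m\<close> has not yet used; it vanishes once \<open>u (Suc m) = 0\<close>.\<close>
  have "(\<Sum>n=1..m. w n * (u n)\<^sup>2) + a (Suc m) * (1 - g m / g (Suc m)) * (u (Suc m))\<^sup>2
      \<le> (\<Sum>n=1..Suc m. a n * (u n - u (n - 1))\<^sup>2)" for m
  proof (induction m)
    case 0
    show ?case using u g by simp
  next
    case (Suc m)
    define x y A B where "x = u (Suc m)" and "y = u (Suc (Suc m))"
      and "A = g (Suc m)" and "B = g (Suc (Suc m))"
    have AB: "A > 0" "B > 0" using g by (auto simp: A_def B_def)
    have "(y - x)\<^sup>2 - ((1 - B / A) * x\<^sup>2 + (1 - A / B) * y\<^sup>2) = (B * x - A * y)\<^sup>2 / (A * B)"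
      using AB by (simp add: field_simps power2_eq_square)
    also have "\<dots> \<ge> 0" using AB by simp
    finally have "(1 - B / A) * x\<^sup>2 + (1 - A / B) * y\<^sup>2 \<le> (y - x)\<^sup>2" by simp
    from mult_left_mono[OF this, of "a (Suc (Suc m))"]
    have edge: "a (Suc (Suc m)) * (1 - B / A) * x\<^sup>2 + a (Suc (Suc m)) * (1 - A / B) * y\<^sup>2
        \<le> a (Suc (Suc m)) * (y - x)\<^sup>2"
      using a by (simp add: algebra_simps)
    have "w (Suc m) * x\<^sup>2 \<le> (a (Suc m) * (1 - g m / A) + a (Suc (Suc m)) * (1 - B / A)) * x\<^sup>2"
      using super[of "Suc m"] by (intro mult_right_mono) (auto simp: A_def B_def)
    with edge Suc show ?case
      by (simp add: x_def y_def A_def B_def algebra_simps)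
  qed
  from this[of M] u show ?thesis by simp
qed

section \<open>The one-variable inequalities\<close>

text \<open>
  The difference \<open>f\<close> of the two sides satisfies \<open>f 0 = f' 0 = 0\<close>, so it suffices that
  \<open>f'' \<ge> 0\<close>. The second derivative vanishes at \<open>0\<close>, and estimating its powers by tangent
  lines or constants that agree with them at \<open>0\<close> leaves a linear function that vanishes at \<open>0\<close>
  and has nonnegative slope.
\<close>

lemma weight_bound_pos_exponent:
  fixes \<beta> x :: real
  assumes \<beta>: "0 < \<beta>" "\<beta> \<le> 1/2" and x: "0 \<le> x" "x < 1"
  shows "1 - (1 - x) powr \<beta> + (1 + x) powr (1 - 2*\<beta>) * (1 - (1 + x) powr \<beta>) \<ge> \<beta>\<^sup>2 * x\<^sup>2"
proof -
  define f where "f = (\<lambda>t. 1 + (1 + t) powr (1 - 2*\<beta>) - (1 - t) powr \<beta> - (1 + t) powr (1 - \<beta>) - \<beta>\<^sup>2 * t\<^sup>2)"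
  define f' where "f' = (\<lambda>t. (1 - 2*\<beta>) * (1 + t) powr (- (2*\<beta>)) + \<beta> * (1 - t) powr (\<beta> - 1)
      - (1 - \<beta>) * (1 + t) powr (- \<beta>) - 2 * \<beta>\<^sup>2 * t)"
  define f'' where "f'' = (\<lambda>t. \<beta> * ((1 - \<beta>) * ((1 - t) powr (\<beta> - 2) + (1 + t) powr (- \<beta> - 1))
      - 2 * (1 - 2*\<beta>) * (1 + t) powr (- (2*\<beta>) - 1) - 2 * \<beta>))"
  have D1: "(f has_real_derivative f' t) (at t)" if "0 \<le> t" "t < 1" for t
    unfolding f_def f'_def using that
    by (auto intro!: derivative_eq_intros simp: algebra_simps)
  have D2: "(f' has_real_derivative f'' t) (at t)" if "0 \<le> t" "t < 1" for t
    unfolding f''_def f'_def using that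
    by (auto intro!: derivative_eq_intros simp: algebra_simps power2_eq_square)
  have f''_nonneg: "f'' t \<ge> 0" if t: "0 \<le> t" "t < 1" for t
  proof -
    define X Y where "X = (1 - t) powr (\<beta> - 2)" and "Y = (1 + t) powr (- \<beta> - 1)"
    have X: "X \<ge> 1 + (2 - \<beta>) * t"
      using powr_ge_tangent[of "1 - t" "\<beta> - 2"] t \<beta> by (simp add: X_def algebra_simps)
    have Y: "Y \<ge> 1 - (1 + \<beta>) * t"
      using powr_ge_tangent[of "1 + t" "- \<beta> - 1"] t \<beta> by (simp add: Y_def algebra_simps)
    have Y1: "Y \<le> 1"
      using powr_mono[of "- \<beta> - 1" 0 "1 + t"] t \<beta> by (simp add: Y_def)
    \<comment> \<open>This exchange costs nothing at \<open>t = 0\<close> and leaves only \<open>X\<close> and \<open>Y\<close>; the coefficient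
      \<open>3\<beta> - 1\<close> of \<open>Y\<close> may have either sign, which decides the direction in which \<open>Y\<close> is
      to be estimated.\<close>
    have "(1 + t) powr (- (2*\<beta>) - 1) \<le> Y" unfolding Y_def using t \<beta> by (intro powr_mono) auto
    hence "2 * (1 - 2*\<beta>) * (1 + t) powr (- (2*\<beta>) - 1) \<le> 2 * (1 - 2*\<beta>) * Y"
      using \<beta> by (intro mult_left_mono) auto
    moreover have "(1 - \<beta>) * X + (3*\<beta> - 1) * Y \<ge> 2 * \<beta>"
    proof (cases "3*\<beta> \<ge> 1")
      case True
      have "2 * \<beta> \<le> 2 * \<beta> + (1 - 2*\<beta>) * (3 + \<beta>) * t" using t \<beta> by simp
      also have "\<dots> = (1 - \<beta>) * (1 + (2 - \<beta>) * t) + (3*\<beta> - 1) * (1 - (1 + \<beta>) * t)"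
        by (simp add: algebra_simps)
      also have "\<dots> \<le> (1 - \<beta>) * X + (3*\<beta> - 1) * Y"
        using X Y True \<beta> by (intro add_mono mult_left_mono) auto
      finally show ?thesis .
    next
      case False
      have "1 + (2 - \<beta>) * t \<ge> 1" using t \<beta> by simp
      hence "(1 - \<beta>) * 1 \<le> (1 - \<beta>) * X" using X \<beta> by (intro mult_left_mono) auto
      moreover have "(3*\<beta> - 1) * 1 \<le> (3*\<beta> - 1) * Y"
        using False Y1 by (intro mult_left_mono_neg) auto
      ultimately show ?thesis by (simp add: algebra_simps)
    qed
    ultimately have "0 \<le> (1 - \<beta>) * (X + Y) - 2 * (1 - 2*\<beta>) * (1 + t) powr (- (2*\<beta>) - 1) - 2 * \<beta>"
      by (simp add: algebra_simps)
    thus ?thesis unfolding f''_def X_def Y_def using \<beta> by simp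
  qed
  have f'_nonneg: "f' t \<ge> 0" if t: "0 \<le> t" "t < 1" for t
  proof -
    have "f' 0 \<le> f' t"
      using t by (intro DERIV_nonneg_imp_nondecreasing[of 0 t f'])
        (auto intro!: exI D2 f''_nonneg)
    thus ?thesis by (simp add: f'_def)
  qed
  have "f 0 \<le> f x"
    using x by (intro DERIV_nonneg_imp_nondecreasing[of 0 x f]) (auto intro!: exI D1 f'_nonneg)
  moreover have "(1 + x) powr (1 - 2*\<beta>) * (1 + x) powr \<beta> = (1 + x) powr (1 - \<beta>)"
    by (simp flip: powr_add)
  ultimately show ?thesis by (simp add: f_def algebra_simps)
qed

text \<open>
  Write \<open>p = 1 + x\<close> and \<open>y = p powr c\<close>; then the left-hand side is
  \<open>1 + p^5 y\<^sup>2 - p^3 y - (1-x) powr \<beta>\<close>. The only power that is not a polynomial in \<open>p\<close> and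
  \<open>y\<close> is \<open>(1-x) powr \<beta>\<close>. Since \<open>1 / (1-x) = p / (1 - x\<^sup>2)\<close> and \<open>1 / (1 - x\<^sup>2) \<le> p powr \<mu>\<close> for
  \<open>\<mu> = x p\<close>, it is at most \<open>y * y powr \<mu> / (1-x)\<^sup>2\<close>, and \<open>y powr \<mu>\<close> lies below its tangent
  at \<open>y = 1\<close> because \<open>\<mu> \<le> 1\<close>. What remains is a quadratic polynomial in \<open>z = y - 1\<close>. Its three
  coefficients are compared with those of \<open>(2 + c)\<^sup>2 x\<^sup>2 = 4 x\<^sup>2 + 4 c x\<^sup>2 + c\<^sup>2 x\<^sup>2\<close> through
  \<open>z \<ge> c x / p\<close>.
\<close>

lemma weight_bound_neg_exponent:
  fixes c x :: real
  assumes c: "0 \<le> c" and x: "0 < x" "x \<le> 1/2"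
  defines "\<beta> \<equiv> - 2 - c"
  shows "1 - (1 - x) powr \<beta> + (1 + x) powr (1 - 2*\<beta>) * (1 - (1 + x) powr \<beta>) \<ge> \<beta>\<^sup>2 * x\<^sup>2"
proof -
  define p \<mu> y z Q where "p = 1 + x" and "\<mu> = x * (1 + x)" and "y = (1 + x) powr c"
    and "z = y - 1" and "Q = 1 / (1 - x)\<^sup>2"
  have p: "p > 0" using x by (simp add: p_def)
  have \<mu>: "0 \<le> \<mu>" "\<mu> \<le> 1"
  proof -
    show "0 \<le> \<mu>" using x by (simp add: \<mu>_def)
    have "x * (1 + x) \<le> 1/2 * (1 + 1/2)" using x by (intro mult_mono) auto
    thus "\<mu> \<le> 1" by (simp add: \<mu>_def)
  qed
  have y: "y \<ge> 1" using x c by (simp add: y_def ge_one_powr_ge_zero)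
  have z: "z \<ge> c * x / p" "z \<ge> 0"
  proof -
    have "1 + (- c) * (1 / p - 1) \<le> (1 / p) powr (- c)"
      using p c by (intro powr_ge_tangent) auto
    also have "\<dots> = y" using p by (simp add: y_def p_def powr_minus powr_divide)
    also have "1 + (- c) * (1 / p - 1) = 1 + c * x / p"
      using p by (simp add: p_def field_simps)
    finally show "z \<ge> c * x / p" by (simp add: z_def)
    show "z \<ge> 0" using y by (simp add: z_def)
  qed
  have Q: "(1 - x) powr \<beta> \<le> Q * (y * (1 + \<mu> * z))"
  proof -
    \<comment> \<open>The exponent \<open>\<mu>\<close> is chosen so that the tangent bound for \<open>(1/p) powr \<mu>\<close> is
      exactly \<open>1 - x\<^sup>2\<close>.\<close>
    have "(1 / p) powr \<mu> \<le> 1 + \<mu> * (1 / p - 1)" using p \<mu> by (intro powr_le_tangent) auto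
    also have "\<dots> = (1 - x) * p" using p by (simp add: \<mu>_def p_def field_simps)
    finally have *: "1 / p powr \<mu> \<le> (1 - x) * p" by (simp add: powr_divide)
    have "1 / (1 - x) \<le> p * p powr \<mu>"
      using * p x by (simp add: field_simps)
    hence "(1 / (1 - x)) powr c \<le> (p * p powr \<mu>) powr c" using c x by (intro powr_mono2) auto
    also have "\<dots> = y * y powr \<mu>"
      using p by (simp add: powr_mult y_def p_def powr_powr mult.commute)
    also have "\<dots> \<le> y * (1 + \<mu> * z)"
      unfolding z_def using y \<mu> by (intro mult_left_mono powr_le_tangent) auto
    finally have "Q * (1 / (1 - x)) powr c \<le> Q * (y * (1 + \<mu> * z))"
      by (intro mult_left_mono) (auto simp: Q_def)
    moreover have "(1 - x) powr \<beta> = Q * (1 / (1 - x)) powr c"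
      using x unfolding \<beta>_def Q_def
      by (simp add: powr_diff powr_minus powr_divide field_simps)
    ultimately show ?thesis by simp
  qed
  have q: "(1 - x)\<^sup>2 > 0" using x by simp
  have x2: "x\<^sup>2 \<le> 1/4" "x ^ 3 \<le> 1/8"
    using power_mono[of x "1/2" 2] power_mono[of x "1/2" 3] x by (simp_all add: power_divide)
  \<comment> \<open>The coefficient of \<open>z ^ 0\<close>: this is the claim for \<open>\<beta> = -2\<close>.\<close>
  have F0: "1 + p^5 - p^3 - Q \<ge> 4 * x\<^sup>2"
  proof -
    have "(1 + p^5 - p^3 - 4 * x\<^sup>2) * (1 - x)\<^sup>2 - 1 = x^3 * (5 - 10*x + 3*x^3 + x^4)"
      unfolding p_def by (simp add: power_numeral_reduce algebra_simps)
    also have "\<dots> \<ge> 0" using x by (intro mult_nonneg_nonneg add_nonneg_nonneg) auto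
    finally have "Q \<le> 1 + p^5 - p^3 - 4 * x\<^sup>2"
      unfolding Q_def using q by (subst pos_divide_le_eq) auto
    thus ?thesis by simp
  qed
  have F1: "2 * p^5 - p^3 - Q * (1 + \<mu>) \<ge> 4 * x * p"
  proof -
    have "(2 * p^5 - p^3 - 4 * x * p) * (1 - x)\<^sup>2 - (1 + \<mu>)
        = x\<^sup>2 * ((7 - 4*x - 15*x\<^sup>2) + x^3 + 6*x^4 + 2*x^5)"
      unfolding p_def \<mu>_def by (simp add: power_numeral_reduce algebra_simps)
    also have "\<dots> \<ge> 0" using x x2 by (intro mult_nonneg_nonneg add_nonneg_nonneg) auto
    finally have "(1 + \<mu>) / (1 - x)\<^sup>2 \<le> 2 * p^5 - p^3 - 4 * x * p"
      using q by (subst pos_divide_le_eq) auto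
    thus ?thesis by (simp add: Q_def)
  qed
  have F2: "p^5 - Q * \<mu> \<ge> p\<^sup>2"
  proof -
    have "(p^5 - p\<^sup>2) * (1 - x)\<^sup>2 - \<mu> = x * p * ((2 - 5*x\<^sup>2 - x^3) + 2*x^4 + x^5)"
      unfolding p_def \<mu>_def by (simp add: power_numeral_reduce algebra_simps)
    also have "\<dots> \<ge> 0" using x x2 p by (intro mult_nonneg_nonneg add_nonneg_nonneg) auto
    finally have "\<mu> / (1 - x)\<^sup>2 \<le> p^5 - p\<^sup>2"
      using q by (subst pos_divide_le_eq) auto
    thus ?thesis by (simp add: Q_def)
  qed
  have "\<beta>\<^sup>2 * x\<^sup>2 = 4 * x\<^sup>2 + (c * x / p) * (4 * x * p) + (c * x / p)\<^sup>2 * p\<^sup>2"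
    using p by (simp add: \<beta>_def field_simps power2_eq_square)
  also have "\<dots> \<le> (1 + p^5 - p^3 - Q) + z * (2 * p^5 - p^3 - Q * (1 + \<mu>)) + z\<^sup>2 * (p^5 - Q * \<mu>)"
    using F0 F1 F2 z c x p by (intro add_mono mult_mono power_mono) auto
  also have "\<dots> = 1 - Q * (y * (1 + \<mu> * z)) + p^5 * y\<^sup>2 - p^3 * y"
    by (simp add: z_def power2_eq_square algebra_simps)
  also have "\<dots> \<le> 1 - (1 - x) powr \<beta> + p^5 * y\<^sup>2 - p^3 * y" using Q by simp
  also have "p^5 * y\<^sup>2 = (1 + x) powr (1 - 2*\<beta>)"
  proof -
    have "(1 + x) powr (1 - 2*\<beta>) = p powr (5 + (c + c))" by (simp add: p_def \<beta>_def)
    also have "\<dots> = p powr 5 * (p powr c * p powr c)" by (simp only: powr_add)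
    finally show ?thesis using p by (simp add: y_def p_def power2_eq_square)
  qed
  also have "p^3 * y = (1 + x) powr (1 - 2*\<beta>) * (1 + x) powr \<beta>"
  proof -
    have "(1 + x) powr (1 - 2*\<beta>) * (1 + x) powr \<beta> = p powr (3 + c)"
      by (simp add: p_def \<beta>_def flip: powr_add)
    also have "\<dots> = p powr 3 * p powr c" by (simp only: powr_add)
    finally show ?thesis using p by (simp add: y_def p_def)
  qed
  finally show ?thesis by (simp add: algebra_simps)
qed

text \<open>The tangent to \<open>2 powr b\<close> at \<open>b = 2\<close> would have the irrational slope \<open>4 ln 2\<close>; the slope
  \<open>2\<close> that comes from the tangent in the base is already enough.\<close>

lemma two_powr_ge_self:
  fixes b :: real
  assumes "b \<ge> 2"
  shows "2 powr b \<ge> b"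
proof -
  have "1 + (2 - b) * (1/2 - 1) \<le> (1/2) powr (2 - b)"
    using assms by (intro powr_ge_tangent) auto
  also have "(1/2::real) powr (2 - b) = 2 powr b / 4" by (simp add: powr_diff powr_divide)
  also have "1 + (2 - b) * (1/2 - 1) = b / 2" by (simp add: field_simps)
  finally show ?thesis using assms by simp
qed

text \<open>At \<open>x = 1\<close> the term \<open>(1-x) powr \<beta>\<close> has to be replaced by the boundary value \<open>0\<close>. In terms
  of \<open>t = 2 powr (-\<beta>)\<close> the left-hand side is \<open>1 + 2 t\<^sup>2 - 2 t\<close>, which equals both
  \<open>t\<^sup>2 + (t - 1)\<^sup>2\<close> and \<open>1/2 + 2 (t - 1/2)\<^sup>2\<close>.\<close>

lemma weight_bound_at_one:
  fixes \<beta> :: real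
  assumes "0 < \<beta> \<and> \<beta> \<le> 1/2 \<or> \<beta> \<le> -2"
  shows "1 + 2 powr (1 - 2*\<beta>) * (1 - 2 powr \<beta>) \<ge> \<beta>\<^sup>2"
proof -
  define t where "t = 2 powr (-\<beta>)"
  have "2 powr (1 - 2*\<beta>) = 2 * t\<^sup>2"
    by (simp add: t_def power2_eq_square powr_diff flip: powr_add) (simp add: powr_minus field_simps)
  moreover have "2 powr \<beta> = 1 / t" and t: "t > 0" by (simp_all add: t_def powr_minus field_simps)
  ultimately have eq: "1 + 2 powr (1 - 2*\<beta>) * (1 - 2 powr \<beta>) = 1 + 2 * t\<^sup>2 - 2 * t"
    by (simp add: field_simps power2_eq_square)
  show ?thesis
  proof (cases "\<beta> \<le> -2")
    case True
    have "-\<beta> \<le> t" unfolding t_def using True by (intro two_powr_ge_self) auto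
    hence "(-\<beta>)\<^sup>2 \<le> t\<^sup>2" using True by (intro power_mono) auto
    also have "\<dots> \<le> t\<^sup>2 + (t - 1)\<^sup>2" by simp
    finally show ?thesis unfolding eq by (simp add: power2_eq_square algebra_simps)
  next
    case False
    hence "\<beta>\<^sup>2 \<le> (1/2)\<^sup>2" using assms by (intro power_mono) auto
    moreover have "0 \<le> 2 * (t - 1/2)\<^sup>2" by simp
    ultimately show ?thesis unfolding eq by (simp add: power2_eq_square algebra_simps)
  qed
qed


section \<open>The inequality\<close>

lemma infsum_eventually_zero:
  fixes f :: "nat \<Rightarrow> real"
  assumes "\<And>n. n > M \<Longrightarrow> f n = 0"
  shows "(\<Sum>\<^sub>\<infinity>n\<in>{1..}. f n) = (\<Sum>n=1..M. f n)"
proof -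
  have "(\<Sum>\<^sub>\<infinity>n\<in>{1..}. f n) = (\<Sum>\<^sub>\<infinity>n\<in>{1..M}. f n)"
    using assms by (intro infsum_cong_neutral) auto
  thus ?thesis by simp
qed

lemma hardy_ineq_finite_iff:
  assumes "\<And>n. n > M \<Longrightarrow> u n = 0"
  shows "hardy_ineq \<alpha> C u \<longleftrightarrow> C * (\<Sum>n=1..M. real n powr (\<alpha> - 2) * (u n)\<^sup>2)
    \<le> (\<Sum>n=1..Suc M. real n powr \<alpha> * (u n - u (n - 1))\<^sup>2)"
proof -
  have "(\<Sum>\<^sub>\<infinity>n\<in>{1..}. \<bar>u n - u (n - 1)\<bar>\<^sup>2 * real n powr \<alpha>)
      = (\<Sum>n=1..Suc M. \<bar>u n - u (n - 1)\<bar>\<^sup>2 * real n powr \<alpha>)"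
    using assms by (intro infsum_eventually_zero) auto
  moreover have "(\<Sum>\<^sub>\<infinity>n\<in>{1..}. \<bar>u n\<bar>\<^sup>2 / (real n)\<^sup>2 * real n powr \<alpha>)
      = (\<Sum>n=1..M. \<bar>u n\<bar>\<^sup>2 / (real n)\<^sup>2 * real n powr \<alpha>)"
    using assms by (intro infsum_eventually_zero) auto
  moreover have "(\<Sum>n=1..M. \<bar>u n\<bar>\<^sup>2 / (real n)\<^sup>2 * real n powr \<alpha>)
      = (\<Sum>n=1..M. real n powr (\<alpha> - 2) * (u n)\<^sup>2)"
    by (intro sum.cong) (auto simp: powr_diff)
  ultimately show ?thesis
    unfolding hardy_ineq_def by (simp add: mult.commute del: sum.cl_ivl_Suc)
qed

text \<open>
  At \<open>n = 1\<close> the convention \<open>0 powr \<beta> = 0\<close>, also for negative \<open>\<beta>\<close>, gives the comparison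
  function the value \<open>0\<close> at the origin. This is the best choice: as \<open>u 0 = 0\<close>, the first edge
  then passes its whole energy on to the site \<open>1\<close>.
\<close>

lemma power_supersolution:
  fixes \<alpha> :: real and n :: nat
  assumes \<alpha>: "\<alpha> \<in> {0..<1} \<union> {5..}" and n: "n \<ge> 1"
  defines "\<beta> \<equiv> (1 - \<alpha>) / 2"
  shows "real n powr \<alpha> * (1 - real (n - 1) powr \<beta> / real n powr \<beta>)
      + real (Suc n) powr \<alpha> * (1 - real (Suc n) powr \<beta> / real n powr \<beta>)
      \<ge> \<beta>\<^sup>2 * real n powr (\<alpha> - 2)"
proof -
  define x where "x = 1 / real n"
  have x: "0 < x" "x \<le> 1" using n by (auto simp: x_def)
  have \<alpha>_eq: "\<alpha> = 1 - 2 * \<beta>" by (simp add: \<beta>_def field_simps)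
  have \<beta>: "0 < \<beta> \<and> \<beta> \<le> 1/2 \<or> \<beta> \<le> -2" using \<alpha> by (auto simp: \<beta>_def)
  have bound: "\<beta>\<^sup>2 * x\<^sup>2 \<le> 1 - (1 - x) powr \<beta> + (1 + x) powr \<alpha> * (1 - (1 + x) powr \<beta>)"
  proof (cases "n = 1")
    case True
    thus ?thesis using weight_bound_at_one[OF \<beta>] by (simp add: x_def \<alpha>_eq)
  next
    case False
    hence x2: "x \<le> 1/2" using n by (simp add: x_def field_simps)
    show ?thesis
    proof (cases "\<beta> \<le> -2")
      case True
      thus ?thesis
        using weight_bound_neg_exponent[of "- 2 - \<beta>" x] x x2 by (simp add: \<alpha>_eq)
    next
      case False
      thus ?thesis
        using weight_bound_pos_exponent[of \<beta> x] \<beta> x x2 by (simp add: \<alpha>_eq)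
    qed
  qed
  have minus: "real (n - 1) powr \<beta> / real n powr \<beta> = (1 - x) powr \<beta>"
    using n by (simp add: x_def of_nat_diff field_simps flip: powr_divide)
  have "real (Suc n) = real n * (1 + x)" using n by (simp add: x_def distrib_left)
  hence plus: "real (Suc n) powr r = real n powr r * (1 + x) powr r" for r
    by (metis powr_mult)
  have "\<beta>\<^sup>2 * real n powr (\<alpha> - 2) = real n powr \<alpha> * (\<beta>\<^sup>2 * x\<^sup>2)"
    using n by (simp add: powr_diff x_def field_simps)
  also have "\<dots> \<le> real n powr \<alpha> * (1 - (1 - x) powr \<beta> + (1 + x) powr \<alpha> * (1 - (1 + x) powr \<beta>))"
    by (intro mult_left_mono bound) auto
  also have "\<dots> = real n powr \<alpha> * (1 - real (n - 1) powr \<beta> / real n powr \<beta>)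
      + real (Suc n) powr \<alpha> * (1 - real (Suc n) powr \<beta> / real n powr \<beta>)"
    unfolding minus plus using n by (simp add: algebra_simps)
  finally show ?thesis .
qed

lemma hardy_ineq_holds:
  fixes \<alpha> :: real
  assumes \<alpha>: "\<alpha> \<in> {0..<1} \<union> {5..}" and u: "u \<in> Cc_N0" "u 0 = 0"
  shows "hardy_ineq \<alpha> ((\<alpha> - 1)\<^sup>2 / 4) u"
proof -
  define \<beta> where "\<beta> = (1 - \<alpha>) / 2"
  have const: "(\<alpha> - 1)\<^sup>2 / 4 = \<beta>\<^sup>2" by (simp add: \<beta>_def power2_eq_square field_simps)
  obtain M where "\<forall>n\<in>{n. u n \<noteq> 0}. n \<le> M"
    using u(1) unfolding Cc_N0_def by (auto simp: finite_nat_set_iff_bounded_le)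
  hence M: "u n = 0" if "n > M" for n using that by force
  have "(\<Sum>n=1..M. \<beta>\<^sup>2 * real n powr (\<alpha> - 2) * (u n)\<^sup>2)
      \<le> (\<Sum>n=1..Suc M. real n powr \<alpha> * (u n - u (n - 1))\<^sup>2)"
  proof (rule hardy_of_supersolution[where g = "\<lambda>n. real n powr \<beta>"])
    show "\<beta>\<^sup>2 * real n powr (\<alpha> - 2)
        \<le> real n powr \<alpha> * (1 - real (n - 1) powr \<beta> / real n powr \<beta>)
          + real (Suc n) powr \<alpha> * (1 - real (Suc n) powr \<beta> / real n powr \<beta>)" if "n \<ge> 1" for n
      using power_supersolution[OF \<alpha> that] by (simp add: \<beta>_def)
  qed (use u M in auto)
  thus ?thesis
    unfolding const by (subst hardy_ineq_finite_iff[OF M]) (simp_all only: sum_distrib_left mult.assoc)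
qed

section \<open>Sharpness of the constant\<close>

text \<open>The energy of \<open>n powr \<beta>\<close> on the edge that ends at \<open>n\<close> is asymptotically \<open>\<beta>\<^sup>2 / n\<close>.\<close>

lemma power_increment_asymp:
  fixes \<beta> :: real
  shows "(\<lambda>n. real n * ((real n powr \<beta> - real (n - 1) powr \<beta>)\<^sup>2 * real n powr (1 - 2*\<beta>)))
    \<longlonglongrightarrow> \<beta>\<^sup>2"
proof -
  have "(\<lambda>n. real n * (1 - (1 - 1 / real n) powr \<beta>)) \<longlonglongrightarrow> \<beta>"
    by real_asymp
  hence "(\<lambda>n. (real n * (1 - (1 - 1 / real n) powr \<beta>))\<^sup>2) \<longlonglongrightarrow> \<beta>\<^sup>2"
    by (rule tendsto_power)
  moreover have "\<forall>\<^sub>F n in sequentially. (real n * (1 - (1 - 1 / real n) powr \<beta>))\<^sup>2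
      = real n * ((real n powr \<beta> - real (n - 1) powr \<beta>)\<^sup>2 * real n powr (1 - 2*\<beta>))"
    using eventually_ge_at_top[of 1]
  proof eventually_elim
    case (elim n)
    have "real (n - 1) = real n * (1 - 1 / real n)"
      using elim by (simp add: of_nat_diff right_diff_distrib)
    hence "real (n - 1) powr \<beta> = real n powr \<beta> * (1 - 1 / real n) powr \<beta>"
      by (metis powr_mult)
    moreover have "real n powr (1 - 2*\<beta>) = real n / (real n powr \<beta>)\<^sup>2"
      using elim by (simp add: powr_diff power2_eq_square flip: powr_add)
    moreover have "(p - p * r)\<^sup>2 = p\<^sup>2 * (1 - r)\<^sup>2" for p r :: real
      by (simp add: power2_eq_square algebra_simps)
    ultimately show ?case
      using elim by (simp add: power_mult_distrib power2_eq_square[of "real n"])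
  qed
  ultimately show ?thesis by (rule Lim_transform_eventually)
qed

lemma hardy_ineq_sharp:
  fixes \<alpha> C :: real
  assumes \<alpha>: "\<alpha> \<ge> 0" and C: "C > (\<alpha> - 1)\<^sup>2 / 4"
  shows "\<exists>u\<in>Cc_N0. u 0 = 0 \<and> \<not> hardy_ineq \<alpha> C u"
proof (rule ccontr)
  assume "\<not> ?thesis"
  hence hardy: "hardy_ineq \<alpha> C u" if "u \<in> Cc_N0" "u 0 = 0" for u using that by blast
  define \<beta> where "\<beta> = (1 - \<alpha>) / 2"
  have \<alpha>_eq: "\<alpha> = 1 - 2 * \<beta>" by (simp add: \<beta>_def field_simps)
  have C\<beta>: "C > \<beta>\<^sup>2" using C by (simp add: \<beta>_def power2_eq_square field_simps)
  \<comment> \<open>Room between \<open>\<beta>\<^sup>2\<close> and \<open>C\<close> absorbs the error in the asymptotics; the finitely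
    many edges where they are not yet accurate enter only through the constant \<open>K\<close>.\<close>
  define C' where "C' = (\<beta>\<^sup>2 + C) / 2"
  have C': "\<beta>\<^sup>2 < C'" "C' < C" using C\<beta> by (auto simp: C'_def)
  have C'_nonneg: "C' \<ge> 0" and C_nonneg: "C \<ge> 0"
    using C' zero_le_power2[of \<beta>] by linarith+
  define d where "d = (\<lambda>n. real n powr \<alpha> * (real n powr \<beta> - real (n - 1) powr \<beta>)\<^sup>2)"
  have d_nonneg: "d n \<ge> 0" for n by (simp add: d_def)
  have "\<forall>\<^sub>F n in sequentially. real n * d n < C'"
    using order_tendstoD(2)[OF power_increment_asymp C'(1)]
    by (simp add: d_def \<alpha>_eq mult.commute mult.left_commute)
  then obtain n0 where n0: "real n * d n < C'" if "n \<ge> n0" for n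
    by (auto simp: eventually_sequentially)
  define K where "K = (\<Sum>n=1..n0. d n)"
  have bulk: "(\<Sum>n=1..N. d n) \<le> K + C' * harm N" for N
  proof -
    have "d n \<le> (if n \<le> n0 then d n else 0) + C' * inverse (real n)" if "n \<in> {1..N}" for n
      using n0[of n] that C'_nonneg by (auto simp: field_simps)
    hence "(\<Sum>n=1..N. d n) \<le> (\<Sum>n=1..N. (if n \<le> n0 then d n else 0) + C' * inverse (real n))"
      by (rule sum_mono)
    also have "\<dots> = (\<Sum>n=1..N. if n \<le> n0 then d n else 0) + C' * harm N"
      by (simp add: sum.distrib sum_distrib_left harm_def)
    also have "(\<Sum>n=1..N. if n \<le> n0 then d n else 0) = (\<Sum>n\<in>{1..N} \<inter> {n. n \<le> n0}. d n)"
      by (simp add: sum.If_cases)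
    also have "\<dots> \<le> K" unfolding K_def using d_nonneg by (intro sum_mono2) auto
    finally show ?thesis by simp
  qed
  have harm_bound: "(C - C') * harm N \<le> K + 2 * 3 powr \<alpha>" if N: "N \<ge> 1" for N :: nat
  proof -
    \<comment> \<open>The linear descent from \<open>N\<close> to \<open>2N\<close> has slope \<open>N powr \<beta> / N\<close>, of the same order as the
      slope of \<open>n powr \<beta>\<close> near \<open>N\<close>, so its energy is comparable to the sum of \<open>1/n\<close> over
      \<open>N < n \<le> 2N\<close>, which is bounded.\<close>
    define u where "u = (\<lambda>n. if n \<le> N then real n powr \<beta>
      else real N powr \<beta> * max 0 (2 - real n / real N))"
    have u_tail: "u n = real N powr \<beta> * max 0 (2 - real n / real N)" if "n \<ge> N" for n
      using that N by (auto simp: u_def)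
    have u0: "u n = 0" if "n > 2 * N" for n
    proof -
      have "real n > 2 * real N" using that by linarith
      thus ?thesis using that N by (simp add: u_def max_def field_simps)
    qed
    have "{n. u n \<noteq> 0} \<subseteq> {..2 * N}" using u0 by (auto simp flip: not_less)
    hence "u \<in> Cc_N0" unfolding Cc_N0_def by (auto intro: finite_subset)
    moreover have "u 0 = 0" by (simp add: u_def)
    ultimately have "hardy_ineq \<alpha> C u" by (rule hardy)
    hence ineq: "C * (\<Sum>n=1..2*N. real n powr (\<alpha> - 2) * (u n)\<^sup>2)
        \<le> (\<Sum>n=1..Suc (2*N). real n powr \<alpha> * (u n - u (n - 1))\<^sup>2)"
      by (subst (asm) hardy_ineq_finite_iff[OF u0])
    have "harm N = (\<Sum>n=1..N. real n powr (\<alpha> - 2) * (u n)\<^sup>2)"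
      unfolding harm_def
    proof (intro sum.cong refl)
      fix n assume n: "n \<in> {1..N}"
      have "real n powr (\<alpha> - 2) * (u n)\<^sup>2 = real n powr (\<alpha> - 2 + (\<beta> + \<beta>))"
        using n by (simp only: powr_add) (simp add: u_def power2_eq_square)
      also have "\<alpha> - 2 + (\<beta> + \<beta>) = -1" by (simp add: \<alpha>_eq)
      finally show "inverse (real n) = real n powr (\<alpha> - 2) * (u n)\<^sup>2"
        using n by (simp add: powr_minus)
    qed
    also have "\<dots> \<le> (\<Sum>n=1..2*N. real n powr (\<alpha> - 2) * (u n)\<^sup>2)"
      by (intro sum_mono2) auto
    finally have "C * harm N \<le> C * (\<Sum>n=1..2*N. real n powr (\<alpha> - 2) * (u n)\<^sup>2)"
      using C_nonneg by (rule mult_left_mono)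
    also note ineq
    also have "(\<Sum>n=1..Suc (2*N). real n powr \<alpha> * (u n - u (n - 1))\<^sup>2)
        = (\<Sum>n=1..N. real n powr \<alpha> * (u n - u (n - 1))\<^sup>2)
          + (\<Sum>n=Suc N..Suc (2*N). real n powr \<alpha> * (u n - u (n - 1))\<^sup>2)"
    proof -
      have split: "{1..Suc (2*N)} = {1..N} \<union> {Suc N..Suc (2*N)}" by auto
      show ?thesis unfolding split by (rule sum.union_disjoint) auto
    qed
    also have "(\<Sum>n=1..N. real n powr \<alpha> * (u n - u (n - 1))\<^sup>2) = (\<Sum>n=1..N. d n)"
      by (intro sum.cong) (auto simp: u_def d_def)
    also have "\<dots> \<le> K + C' * harm N" by (rule bulk)
    also have "(\<Sum>n=Suc N..Suc (2*N). real n powr \<alpha> * (u n - u (n - 1))\<^sup>2) \<le> 2 * 3 powr \<alpha>"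
    proof -
      have "real n powr \<alpha> * (u n - u (n - 1))\<^sup>2 \<le> (3 * real N) powr \<alpha> * (real N powr \<beta> / real N)\<^sup>2"
        if n: "n \<in> {Suc N..Suc (2*N)}" for n
      proof (intro mult_mono)
        have "real n \<le> real (3 * N)" using n N by (subst of_nat_le_iff) auto
        thus "real n powr \<alpha> \<le> (3 * real N) powr \<alpha>" using \<alpha> by (intro powr_mono2) auto
        have "\<bar>max 0 (2 - real n / real N) - max 0 (2 - real (n - 1) / real N)\<bar>
            \<le> \<bar>real n / real N - real (n - 1) / real N\<bar>" by linarith
        also have "\<dots> = 1 / real N"
          using n N by (simp add: of_nat_diff flip: diff_divide_distrib)
        finally have "real N powr \<beta> * \<bar>max 0 (2 - real n / real N) - max 0 (2 - real (n - 1) / real N)\<bar>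
            \<le> real N powr \<beta> * (1 / real N)" by (intro mult_left_mono) auto
        moreover have "u n - u (n - 1)
            = real N powr \<beta> * (max 0 (2 - real n / real N) - max 0 (2 - real (n - 1) / real N))"
        proof -
          have "N \<le> n" "N \<le> n - 1" using n by auto
          thus ?thesis by (simp only: u_tail right_diff_distrib)
        qed
        ultimately have "\<bar>u n - u (n - 1)\<bar> \<le> real N powr \<beta> / real N"
          by (simp add: abs_mult)
        hence "\<bar>u n - u (n - 1)\<bar>\<^sup>2 \<le> (real N powr \<beta> / real N)\<^sup>2" by (intro power_mono) auto
        thus "(u n - u (n - 1))\<^sup>2 \<le> (real N powr \<beta> / real N)\<^sup>2" by simp
      qed auto
      hence "(\<Sum>n=Suc N..Suc (2*N). real n powr \<alpha> * (u n - u (n - 1))\<^sup>2)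
          \<le> real (card {Suc N..Suc (2*N)}) * ((3 * real N) powr \<alpha> * (real N powr \<beta> / real N)\<^sup>2)"
        by (rule sum_bounded_above)
      also have "\<dots> \<le> (2 * real N) * ((3 * real N) powr \<alpha> * (real N powr \<beta> / real N)\<^sup>2)"
        using N by (intro mult_right_mono) auto
      also have "\<dots> = 2 * 3 powr \<alpha> * (real N powr \<alpha> * (real N powr \<beta> * real N powr \<beta>) / real N)"
        using N by (simp add: powr_mult power2_eq_square)
      also have "real N powr \<alpha> * (real N powr \<beta> * real N powr \<beta>) = real N powr (\<alpha> + (\<beta> + \<beta>))"
        by (simp only: powr_add)
      also have "\<alpha> + (\<beta> + \<beta>) = 1" by (simp add: \<alpha>_eq)
      finally show ?thesis using N by simp
    qed
    finally show ?thesis by (simp add: algebra_simps)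
  qed
  have "\<forall>\<^sub>F N in sequentially. harm N > (K + 2 * 3 powr \<alpha>) / (C - C') \<and> N \<ge> 1"
    using harm_at_top by (intro eventually_conj eventually_ge_at_top) (auto simp: filterlim_at_top_dense)
  then obtain N where "harm N > (K + 2 * 3 powr \<alpha>) / (C - C')" "N \<ge> 1"
    by (auto simp: eventually_sequentially)
  thus False using harm_bound[of N] C' by (simp add: field_simps)
qed

theorem corollary2p3:
  fixes \<alpha> :: real
  assumes "\<alpha> \<in> {0..<1} \<union> {5..}"
  shows "(\<forall>u\<in>Cc_N0. u 0 = 0 \<longrightarrow> hardy_ineq \<alpha> ((\<alpha> - 1)\<^sup>2 / 4) u) \<and>
         (\<forall>C > (\<alpha> - 1)\<^sup>2 / 4. \<exists>u\<in>Cc_N0. u 0 = 0 \<and> \<not> hardy_ineq \<alpha> C u)"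
proof -
  from assms have "\<alpha> \<ge> 0" by auto
  with assms hardy_ineq_holds hardy_ineq_sharp show ?thesis by blast
qed

end
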